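(* Let $\mathcal{I}=\{1,\dots,N\}$ be the set of agents with coupling graph $G=(\mathcal{I},E)$, behavior sets $\mathbb{M}_i$, local specification sets $S_i\subseteq\mathbb{M}_i$, global specification set $S\subseteq\mathbb{M}=\mathbb{M}_1\times\cdots\times\mathbb{M}_N$, and assumption sets $W_j^i$ ($i\in\mathcal{I}$, $j\in\mathcal{N}_i$). Suppose $S_i\neq\emptyset$ for every $i\in\mathcal{I}$. Let $\mathcal{C}:=(\mathbb{M},S)$ be the global contract, $\mathcal{C}_C$ the contract of a coalition $C$, and $P_1:=\{\{1\},\dots,\{N\}\}$ the partition into singletons. Then $$\bigotimes_{C\in P}\mathcal{C}_C\preceq\mathcal{C}\quad\text{for every partition }P$$ if and only if all of the following hold: (1) $S_j\subseteq W_j^{i}$ for every $i\in\mathcal{I}$ and every $j\in\mathcal{N}_i$; (2) $\prod_{i\in\mathcal{I}}S_i\subseteq S$; (3) there do not exist edges $(\{j_1\},\{i_1\}),(\{j_2\},\{i_2\})\in E_{P_1}$ and disjoint coalitions $C$ and $D$ such that $\{i_1,j_2\}\subseteq C$ and $\{j_1,i_2\}\subseteq D$.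
   Context: Agents and behaviors. $\mathcal{I}=\{1,\dots,N\}$ is a finite set of agents and $T$ is a fixed finite horizon. Agent $i$ has input $u_i[t]\in\mathbb{R}^{m_i}$ and state $x_i[t]\in\mathbb{R}^{n_i}$; its behavior is $w_i=(u_i[0],\dots,u_i[T-1],x_i[0],\dots,x_i[T])$. $\mathbb{M}_i\subseteq\prod_{t=0}^{T-1}\mathbb{R}^{m_i}\times\prod_{t=0}^{T}\mathbb{R}^{n_i}$ is the given set of behaviors agent $i$ can realize (no particular dynamics is assumed). Network behaviors are $w=(w_1,\dots,w_N)\in\mathbb{M}:=\mathbb{M}_1\times\cdots\times\mathbb{M}_N$. Specifications. $S:=\{w\in\mathbb{M}\mid (w,0)\models\varphi\}$ for a given signal temporal logic (STL) formula $\varphi$ over network behaviors, and $S_i:=\{w_i\in\mathbb{M}_i\mid (w_i,0)\models\varphi_i\}$ for a given STL formula $\varphi_i$ over behaviors of agent $i$. STL formulas are built from predicates $p(w[t])\ge 0$ (with $p$ real-valued and $w[t]$ the vector of inputs and states at time $t$) by $\neg,\wedge,\vee$ and the time-bounded operators $F_{[a,b]}$ (eventually), $G_{[a,b]}$ (always), $U_{[a,b]}$ (until), with the usual discrete-time semantics; $(w,t)\models\varphi$ means that $w$ satisfies $\varphi$ at time $t$. The formulas $\varphi,\varphi_i$ enter the statement only through the sets $S\subseteq\mathbb{M}$ and $S_i\subseteq\mathbb{M}_i$. Graph, coalitions, partitions. $G=(\mathcal{I},E)$ is a simple undirected graph, $\mathcal{N}_i:=\{j\in\mathcal{I}\mid\{i,j\}\in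 E\}$. A coalition is a nonempty subset $C\subseteq\mathcal{I}$ inducing a connected subgraph of $G$; $\mathcal{N}_C:=(\bigcup_{i\in C}\mathcal{N}_i)\setminus C$. A partition is a family $P$ of pairwise disjoint coalitions whose union is $\mathcal{I}$. Contracts. A contract is a pair $(\mathcal{A},\mathcal{G})$ with $\mathcal{A},\mathcal{G}\subseteq\mathbb{M}$; it is saturated if $\mathcal{G}\supseteq\mathbb{M}\setminus\mathcal{A}$. All contracts here are saturated. $(\mathcal{A}_2,\mathcal{G}_2)\preceq(\mathcal{A}_1,\mathcal{G}_1)$ (refinement) means $\mathcal{A}_2\supseteq\mathcal{A}_1$ and $\mathcal{G}_2\subseteq\mathcal{G}_1$. The composition of a finite family of saturated contracts $(\mathcal{A}_l,\mathcal{G}_l)$, $l\in L$, is $\bigotimes_{l\in L}(\mathcal{A}_l,\mathcal{G}_l)=(\mathcal{A},\mathcal{G})$ with $\mathcal{G}=\bigcap_{l\in L}\mathcal{G}_l$ and $\mathcal{A}=\big(\bigcap_{l\in L}\mathcal{A}_l\big)\cup\big(\mathbb{M}\setminus\bigcap_{l\in L}\mathcal{G}_l\big)$. Assumptions and coalition contracts. For each $i\in\mathcal{I}$ and $j\in\mathcal{N}_i$, agent $i$ holds an assumption $W_j^i\subseteq\prod_{t=0}^{T-1}\mathbb{R}^{m_j}\times\prod_{t=0}^{T}\mathbb{R}^{n_j}$ (not necessarily contained in $\mathbb{M}_j$). For a coalition $C$ and $j\in\mathcal{N}_C$, $W_j^C:=\bigcap\{W_j^i\mid i\in C,\ j\in\mathcal{N}_i\}$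 (so $W_j^{\{i\}}=W_j^i$). The contract of $C$ is $\mathcal{C}_C:=(\mathcal{A}_C,\hat{\mathcal{G}}_C)$, where $\mathcal{A}_C:=\{w\in\mathbb{M}\mid w_j\in W_j^C\ \forall j\in\mathcal{N}_C\}$, $\mathcal{G}_C:=\{w\in\mathbb{M}\mid w_i\in S_i\ \forall i\in C\}$, and $\hat{\mathcal{G}}_C:=\mathcal{G}_C\cup(\mathbb{M}\setminus\mathcal{A}_C)$. Assumption graph. For a partition $P$, $\Gamma_P:=(P,E_P)$ is the directed graph with vertex set $P$ and edge set $E_P:=\{(D,C)\mid C,D\in P,\ \exists j\in D\cap\mathcal{N}_C:\ \mathbb{M}_j\not\subseteq W_j^C\}$. In particular $(\{j\},\{i\})\in E_{P_1}$ if and only if $j\in\mathcal{N}_i$ and $\mathbb{M}_j\not\subseteq W_j^i$. *)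

theory Defs
  imports "Jordan_Normal_Form.Matrix" "HOL-Library.FuncSet" "HOL-Library.Disjoint_Sets"
begin

section \<open>Behaviors\<close>

text \<open>
  The dimensions differ from agent to agent, so a vector of \<open>\<real>\<^sup>p\<close> is an element of
  \<open>carrier_vec p\<close>. A behavior is a pair (input trajectory on \<open>0, \<dots>, T - 1\<close>,
  state trajectory on \<open>0, \<dots>, T\<close>); trajectories are extensional functions of time, so that
  equality of behaviors only depends on the values at these times.
\<close>

type_synonym behavior = "(nat \<Rightarrow> real vec) \<times> (nat \<Rightarrow> real vec)"

definition behavior_space :: "nat \<Rightarrow> nat \<Rightarrow> nat \<Rightarrow> behavior set" where
  "behavior_space T p q =
     ({..<T} \<rightarrow>\<^sub>E carrier_vec p) \<times> ({..T} \<rightarrow>\<^sub>E carrier_vec q)"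

type_synonym network_behavior = "nat \<Rightarrow> behavior"


section \<open>Coupling graph, coalitions, partitions\<close>

definition simple_graph :: "nat set \<Rightarrow> nat set set \<Rightarrow> bool" where
  "simple_graph V E \<longleftrightarrow> (\<forall>e\<in>E. e \<subseteq> V \<and> card e = 2)"

definition neighbors :: "nat set set \<Rightarrow> nat \<Rightarrow> nat set" where
  "neighbors E i = {j. {i, j} \<in> E}"

definition induces_connected :: "nat set set \<Rightarrow> nat set \<Rightarrow> bool" where
  "induces_connected E C \<longleftrightarrow>
     (\<forall>u\<in>C. \<forall>v\<in>C. (u, v) \<in> {(a, b). a \<in> C \<and> b \<in> C \<and> {a, b} \<in> E}\<^sup>*)"

definition coalition :: "nat set \<Rightarrow> nat set set \<Rightarrow> nat set \<Rightarrow> bool" where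
  "coalition V E C \<longleftrightarrow> C \<noteq> {} \<and> C \<subseteq> V \<and> induces_connected E C"

definition coalition_neighbors :: "nat set set \<Rightarrow> nat set \<Rightarrow> nat set" where
  "coalition_neighbors E C = (\<Union>i\<in>C. neighbors E i) - C"

definition coalition_partition :: "nat set \<Rightarrow> nat set set \<Rightarrow> nat set set \<Rightarrow> bool" where
  "coalition_partition V E P \<longleftrightarrow> partition_on V P \<and> (\<forall>C\<in>P. coalition V E C)"

definition singleton_partition :: "nat set \<Rightarrow> nat set set" where
  "singleton_partition V = (\<lambda>i. {i}) ` V"


section \<open>Contracts\<close>

type_synonym 'w contract = "'w set \<times> 'w set"

definition saturated_contract :: "'w set \<Rightarrow> 'w contract \<Rightarrow> bool" where
  "saturated_contract M c \<longleftrightarrow> fst c \<subseteq> M \<and> snd c \<subseteq> M \<and> M - fst c \<subseteq> snd c"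

definition refines :: "'w contract \<Rightarrow> 'w contract \<Rightarrow> bool" (infix "\<preceq>\<^sub>c" 50) where
  "c2 \<preceq>\<^sub>c c1 \<longleftrightarrow> fst c1 \<subseteq> fst c2 \<and> snd c2 \<subseteq> snd c1"

text \<open>
  Intersections are formed among subsets of \<open>M\<close>; intersecting with \<open>M\<close> only has an
  effect for the empty family, where \<open>\<Inter>\<close> would otherwise yield \<open>UNIV\<close>.
\<close>

definition contract_composition :: "'w set \<Rightarrow> 'l set \<Rightarrow> ('l \<Rightarrow> 'w contract) \<Rightarrow> 'w contract" where
  "contract_composition M L c =
     (let G = M \<inter> (\<Inter>l\<in>L. snd (c l));
          A = (M \<inter> (\<Inter>l\<in>L. fst (c l))) \<union> (M - G)
      in (A, G))"


section \<open>Assumptions and coalition contracts\<close>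

text \<open>
  \<open>W i j\<close> is the assumption that agent \<open>i\<close> holds on its neighbor \<open>j\<close>; only the values with
  \<open>j \<in> neighbors E i\<close> are used. \<open>M\<close> is the set of network behaviors, \<open>Mi i\<close> and \<open>Si i\<close> are the
  behavior set and the local specification set of agent \<open>i\<close>.
\<close>

definition coalition_assumption ::
  "nat set set \<Rightarrow> (nat \<Rightarrow> nat \<Rightarrow> behavior set) \<Rightarrow> nat set \<Rightarrow> nat \<Rightarrow> behavior set" where
  "coalition_assumption E W C j = \<Inter> {W i j | i. i \<in> C \<and> j \<in> neighbors E i}"

definition assume_set ::
  "network_behavior set \<Rightarrow> nat set set \<Rightarrow> (nat \<Rightarrow> nat \<Rightarrow> behavior set) \<Rightarrow> nat set
     \<Rightarrow> network_behavior set" where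
  "assume_set M E W C =
     {w \<in> M. \<forall>j\<in>coalition_neighbors E C. w j \<in> coalition_assumption E W C j}"

definition guarantee_set ::
  "network_behavior set \<Rightarrow> (nat \<Rightarrow> behavior set) \<Rightarrow> nat set \<Rightarrow> network_behavior set" where
  "guarantee_set M Si C = {w \<in> M. \<forall>i\<in>C. w i \<in> Si i}"

definition coalition_contract ::
  "network_behavior set \<Rightarrow> nat set set \<Rightarrow> (nat \<Rightarrow> nat \<Rightarrow> behavior set)
     \<Rightarrow> (nat \<Rightarrow> behavior set) \<Rightarrow> nat set \<Rightarrow> network_behavior contract" where
  "coalition_contract M E W Si C =
     (assume_set M E W C, guarantee_set M Si C \<union> (M - assume_set M E W C))"

definition assumption_edges ::
  "nat set set \<Rightarrow> (nat \<Rightarrow> behavior set) \<Rightarrow> (nat \<Rightarrow> nat \<Rightarrow> behavior set) \<Rightarrow> nat set set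
     \<Rightarrow> (nat set \<times> nat set) set" where
  "assumption_edges E Mi W P =
     {(D, C). C \<in> P \<and> D \<in> P \<and>
        (\<exists>j \<in> D \<inter> coalition_neighbors E C. \<not> Mi j \<subseteq> coalition_assumption E W C j)}"


section \<open>Consistency checks\<close>

lemma saturated_coalition_contract: "saturated_contract M (coalition_contract M E W Si C)"
  by (auto simp: saturated_contract_def coalition_contract_def assume_set_def guarantee_set_def)

lemma saturated_global_contract: "S \<subseteq> M \<Longrightarrow> saturated_contract M (M, S)"
  by (simp add: saturated_contract_def)

lemma saturated_contract_composition:
  "(\<And>l. l \<in> L \<Longrightarrow> saturated_contract M (c l)) \<Longrightarrow> saturated_contract M (contract_composition M L c)"
  by (auto simp: saturated_contract_def contract_composition_def Let_def)

lemma coalition_assumption_singleton: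
  "j \<in> neighbors E i \<Longrightarrow> coalition_assumption E W {i} j = W i j"
  by (auto simp: coalition_assumption_def)

lemma assumption_edges_singletons:
  assumes "simple_graph V E" "i \<in> V" "j \<in> V"
  shows "({j}, {i}) \<in> assumption_edges E Mi W (singleton_partition V)
           \<longleftrightarrow> j \<in> neighbors E i \<and> \<not> Mi j \<subseteq> W i j"
proof -
  have "{i} \<notin> E"
    using assms(1) by (auto simp: simple_graph_def)
  then have "coalition_neighbors E {i} = neighbors E i"
    by (auto simp: coalition_neighbors_def neighbors_def)
  then show ?thesis
    using assms(2,3) coalition_assumption_singleton[of j E i W]
    by (auto simp: assumption_edges_def singleton_partition_def)
qed

end

theory Submission
  imports Defs
begin

text \<open>
  Unfolding refinement, the left-hand side says: whenever every coalition of \<open>P\<close> that has its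
  assumption satisfied by \<open>w \<in> M\<close> also fulfils its guarantee, then all assumptions hold and
  \<open>w \<in> S\<close>.

  If (1)--(3) hold and \<open>w\<close> violates the assumption of some \<open>C \<in> P\<close>, then by (1) the coalition
  containing the blamed neighbor misses its guarantee, so its own assumption is violated as well.
  Iterating in the finite set \<open>P\<close> yields a cycle of coalitions; merging all but one of them gives
  two disjoint coalitions blaming each other, against (3). Conversely, if \<open>C\<close> and \<open>D\<close> violate (3),
  complete them by singletons to a partition and let \<open>w\<close> violate the two assumptions
  while all other agents satisfy their specifications: \<open>C\<close> and \<open>D\<close> then excuse each other.
\<close>

section \<open>Merging coalitions, and cycles of self-maps\<close>

lemma neighbors_in_graph:
  assumes "simple_graph V E" "j \<in> neighbors E i"
  shows "i \<in> V" "j \<in> V" "i \<noteq> j"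
  using assms by (auto simp: simple_graph_def neighbors_def)

lemma coalition_singleton: "i \<in> V \<Longrightarrow> coalition V E {i}"
  by (auto simp: coalition_def induces_connected_def)

lemma coalition_partition_singletons: "coalition_partition V E (singleton_partition V)"
  by (auto simp: coalition_partition_def singleton_partition_def coalition_singleton
      intro!: partition_onI)

text \<open>Paths inside \<open>A\<close> or \<open>B\<close> survive in the union, and the edge
  \<open>{a, b}\<close> links the two sides in either direction.\<close>

lemma coalition_union:
  assumes "coalition V E A" "coalition V E B" "a \<in> A" "b \<in> B" "{a, b} \<in> E"
  shows "coalition V E (A \<union> B)"
proof -
  define r where "r C = {(a, b). a \<in> C \<and> b \<in> C \<and> {a, b} \<in> E}" for C
  have mono: "(u, v) \<in> (r (A \<union> B))\<^sup>*" if "(u, v) \<in> (r C)\<^sup>*" "C \<subseteq> A \<union> B" for u v C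
    using that rtrancl_mono[of "r C" "r (A \<union> B)"] by (auto simp: r_def)
  have A: "(u, v) \<in> (r (A \<union> B))\<^sup>*" if "u \<in> A" "v \<in> A" for u v
    using assms(1) that by (intro mono[of _ _ A]) (auto simp: coalition_def induces_connected_def r_def)
  have B: "(u, v) \<in> (r (A \<union> B))\<^sup>*" if "u \<in> B" "v \<in> B" for u v
    using assms(2) that by (intro mono[of _ _ B]) (auto simp: coalition_def induces_connected_def r_def)
  have ab: "(a, b) \<in> r (A \<union> B)" "(b, a) \<in> r (A \<union> B)"
    using assms(3-5) by (auto simp: r_def insert_commute)
  have AB: "(u, v) \<in> (r (A \<union> B))\<^sup>*" if "u \<in> A" "v \<in> B" for u v
    using A[OF that(1) assms(3)] ab(1) B[OF assms(4) that(2)] by (meson rtrancl.simps rtrancl_trans)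
  have BA: "(u, v) \<in> (r (A \<union> B))\<^sup>*" if "u \<in> B" "v \<in> A" for u v
    using B[OF that(1) assms(4)] ab(2) A[OF assms(3) that(2)] by (meson rtrancl.simps rtrancl_trans)
  have "induces_connected E (A \<union> B)"
    unfolding induces_connected_def r_def[symmetric] using A B AB BA by blast
  then show ?thesis
    using assms(1,2) by (auto simp: coalition_def)
qed

lemma coalition_chain:
  assumes "\<And>i. i \<le> k \<Longrightarrow> coalition V E (X i)"
    and "\<And>i. i < k \<Longrightarrow> \<exists>a\<in>X i. \<exists>b\<in>X (Suc i). {a, b} \<in> E"
  shows "coalition V E (\<Union>i\<le>k. X i)"
  using assms
proof (induction k)
  case 0
  then show ?case by simp
next
  case (Suc k)
  obtain a b where "a \<in> X k" "b \<in> X (Suc k)" "{a, b} \<in> E"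
    using Suc.prems(2)[of k] by auto
  then have "coalition V E ((\<Union>i\<le>k. X i) \<union> X (Suc k))"
    using Suc by (intro coalition_union[of _ _ _ _ a b]) auto
  then show ?case by (simp add: atMost_Suc Un_commute)
qed

text \<open>By pigeonhole an orbit repeats, so it contains a periodic point \<open>x\<close>;
  \<open>Suc k\<close> is its least positive return time.\<close>

lemma finite_self_map_cycle:
  assumes "finite B" "B \<noteq> {}" "f ` B \<subseteq> B"
  obtains x k where "x \<in> B" "(f ^^ Suc k) x = x" "\<And>i. 0 < i \<Longrightarrow> i \<le> k \<Longrightarrow> (f ^^ i) x \<noteq> x"
proof -
  obtain b where b: "b \<in> B" using assms(2) by auto
  have iter: "(f ^^ i) b \<in> B" for i
    using b assms(3) by (induction i) auto
  have "\<not> inj (\<lambda>i. (f ^^ i) b)"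
    using iter assms(1) by (metis finite_imageD finite_subset image_subset_iff infinite_UNIV_nat)
  then obtain p q where pq: "p < q" "(f ^^ p) b = (f ^^ q) b"
    by (metis (mono_tags, lifting) injI linorder_neqE_nat)
  define x where "x = (f ^^ p) b"
  have "(f ^^ (q - p)) x = (f ^^ (q - p + p)) b"
    by (simp add: x_def funpow_add)
  then have ex: "0 < q - p \<and> (f ^^ (q - p)) x = x"
    using pq by (simp add: x_def)
  define l where "l = (LEAST l. 0 < l \<and> (f ^^ l) x = x)"
  have l: "0 < l" "(f ^^ l) x = x" and least: "\<And>i. 0 < i \<Longrightarrow> (f ^^ i) x = x \<Longrightarrow> l \<le> i"
    unfolding l_def using LeastI[of "\<lambda>l. 0 < l \<and> (f ^^ l) x = x", OF ex]
    by (auto intro: Least_le)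
  show thesis
  proof (rule that[of x "l - 1"])
    show "x \<in> B" using iter by (simp add: x_def)
    show "(f ^^ Suc (l - 1)) x = x" using l by simp
    show "(f ^^ i) x \<noteq> x" if "0 < i" "i \<le> l - 1" for i
      using least[of i] that l(1) by auto
  qed
qed

section \<open>Refinement as a pointwise condition, and the blame cycle\<close>

lemma assume_set_iff:
  "w \<in> assume_set M E W C \<longleftrightarrow> w \<in> M \<and> (\<forall>i\<in>C. \<forall>j\<in>neighbors E i - C. w j \<in> W i j)"
  by (auto simp: assume_set_def coalition_neighbors_def coalition_assumption_def)

text \<open>The premise says that \<open>w\<close> lies in every saturated guarantee. Any other
  \<open>w\<close> belongs to the composed assumption automatically, so only such \<open>w\<close>
  impose a condition.\<close>

lemma composition_refines_iff:
  "contract_composition M P (coalition_contract M E W Si) \<preceq>\<^sub>c (M, S) \<longleftrightarrow>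
     (\<forall>w\<in>M. (\<forall>C\<in>P. w \<in> assume_set M E W C \<longrightarrow> (\<forall>i\<in>C. w i \<in> Si i)) \<longrightarrow>
        w \<in> S \<and> (\<forall>C\<in>P. w \<in> assume_set M E W C))"
  by (auto simp: refines_def contract_composition_def coalition_contract_def Let_def
      guarantee_set_def)

text \<open>Here \<open>no_mutual\<close> is (3) with each edge replaced by an actual violation
  committed by \<open>w\<close>; the cycle of blame produces exactly such violations.\<close>

lemma all_assumptions_hold:
  assumes "simple_graph V E" "finite V" "coalition_partition V E P"
    and sat: "\<And>i j. i \<in> V \<Longrightarrow> j \<in> neighbors E i \<Longrightarrow> Si j \<subseteq> W i j"
    and no_mutual: "\<And>j1 i1 j2 i2 C D.
      \<lbrakk>j1 \<in> neighbors E i1; w j1 \<notin> W i1 j1; j2 \<in> neighbors E i2; w j2 \<notin> W i2 j2;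
       coalition V E C; coalition V E D; C \<inter> D = {}; i1 \<in> C; j2 \<in> C; j1 \<in> D; i2 \<in> D\<rbrakk> \<Longrightarrow> False"
    and w: "w \<in> M"
    and fulfil: "\<And>C. C \<in> P \<Longrightarrow> w \<in> assume_set M E W C \<Longrightarrow> \<forall>i\<in>C. w i \<in> Si i"
    and "C \<in> P"
  shows "w \<in> assume_set M E W C"
proof (rule ccontr)
  assume viol: "w \<notin> assume_set M E W C"
  have P: "\<Union>P = V" "disjoint P" and coal: "\<And>C. C \<in> P \<Longrightarrow> coalition V E C"
    using assms(3) by (auto simp: coalition_partition_def partition_on_def)
  define B where "B = {C \<in> P. w \<notin> assume_set M E W C}"
  define blames where "blames C D \<longleftrightarrow>
    (\<exists>i\<in>C. \<exists>j\<in>D. j \<in> neighbors E i \<and> w j \<notin> W i j)" for C D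
  \<comment> \<open>The blamed agent lies outside \<open>C\<close>, hence in another block. By
    \<open>sat\<close> it misses its specification, so by \<open>fulfil\<close> that block must have
    a violated assumption too.\<close>
  have "\<exists>D\<in>B. D \<noteq> C \<and> blames C D" if C: "C \<in> B" for C
  proof -
    obtain i j where ij: "i \<in> C" "j \<in> neighbors E i" "j \<notin> C" "w j \<notin> W i j"
      using C w by (auto simp: B_def assume_set_iff)
    note V = neighbors_in_graph[OF assms(1) ij(2)]
    obtain D where D: "D \<in> P" "j \<in> D" using V P by auto
    have "w j \<notin> Si j" using sat[OF V(1) ij(2)] ij(4) by auto
    then have "D \<in> B" using fulfil[OF D(1)] D by (auto simp: B_def)
    then show ?thesis using ij D by (auto simp: blames_def)
  qed
  then obtain f where f: "\<And>C. C \<in> B \<Longrightarrow> f C \<in> B \<and> f C \<noteq> C \<and> blames C (f C)"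
    by metis
  have "finite B"
    using finite_UnionD[of P] assms(2) P(1) by (simp add: B_def)
  moreover have "B \<noteq> {}" "f ` B \<subseteq> B"
    using f \<open>C \<in> P\<close> viol by (auto simp: B_def)
  ultimately obtain A k where A: "A \<in> B" "(f ^^ Suc k) A = A"
    and min: "\<And>i. 0 < i \<Longrightarrow> i \<le> k \<Longrightarrow> (f ^^ i) A \<noteq> A"
    by (rule finite_self_map_cycle) blast
  have iter: "(f ^^ i) A \<in> B" for i
    using A(1) f by (induction i) auto
  have step: "blames ((f ^^ i) A) ((f ^^ Suc i) A)" for i
    using f iter[of i] by simp
  have edge: "\<exists>a\<in>(f ^^ i) A. \<exists>b\<in>(f ^^ Suc i) A. {a, b} \<in> E" for i
    using step[of i] unfolding blames_def neighbors_def by blast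
  \<comment> \<open>A cycle of length one would be a coalition blaming itself.\<close>
  have "k \<noteq> 0" using A(2) f[OF A(1)] by (cases k) auto
  \<comment> \<open>\<open>D\<close> merges iterates 1 to \<open>k\<close>, that is, the whole cycle
    except \<open>A\<close>. Each blame is an edge of the graph, which keeps \<open>D\<close>
    connected.\<close>
  define D where "D = (\<Union>i\<le>k - 1. (f ^^ Suc i) A)"
  have "coalition V E D"
    unfolding D_def using iter coal edge by (intro coalition_chain) (auto simp: B_def simp del: funpow.simps)
  \<comment> \<open>Minimality of the return time makes these blocks of \<open>P\<close> different
    from \<open>A\<close>.\<close>
  have "A \<inter> (f ^^ Suc i) A = {}" if "i \<le> k - 1" for i
  proof (rule disjointD[OF P(2)])
    show "A \<noteq> (f ^^ Suc i) A" using min[of "Suc i"] that \<open>k \<noteq> 0\<close> by force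
  qed (use A(1) iter[of "Suc i"] in \<open>auto simp: B_def\<close>)
  then have "A \<inter> D = {}"
    by (auto simp: D_def simp del: funpow.simps)
  obtain i1 j1 where 1: "i1 \<in> A" "j1 \<in> (f ^^ Suc 0) A" "j1 \<in> neighbors E i1" "w j1 \<notin> W i1 j1"
    using step[of 0] by (auto simp: blames_def)
  \<comment> \<open>The last step closes the cycle: a member of \<open>D\<close> blames an agent of
    \<open>A\<close>.\<close>
  obtain i2 j2 where 2: "i2 \<in> (f ^^ k) A" "j2 \<in> A" "j2 \<in> neighbors E i2" "w j2 \<notin> W i2 j2"
    using step[of k] unfolding A(2) blames_def by auto
  have "j1 \<in> D" using 1(2) unfolding D_def by blast
  moreover have "i2 \<in> D"
    using 2(1) \<open>k \<noteq> 0\<close> unfolding D_def by (intro UN_I[of "k - 1"]) auto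
  moreover have "coalition V E A"
    using A(1) coal by (simp add: B_def)
  ultimately show False
    using no_mutual[of j1 i1 j2 i2 A D] 1 2 \<open>coalition V E D\<close> \<open>A \<inter> D = {}\<close> by blast
qed

section \<open>The two implications of the equivalence\<close>

lemma coalition_partition_two:
  assumes "coalition V E C" "coalition V E D" "C \<inter> D = {}"
  shows "coalition_partition V E ({C, D} \<union> singleton_partition (V - C - D))"
proof -
  have "partition_on V ({C, D} \<union> singleton_partition (V - C - D))"
    using assms by (intro partition_onI) (auto simp: coalition_def singleton_partition_def disjnt_def)
  then show ?thesis
    using assms by (auto simp: coalition_partition_def singleton_partition_def coalition_singleton)
qed

theorem theorem2:
  fixes N T :: nat
    and m n :: "nat \<Rightarrow> nat"
    and E :: "nat set set"
    and Mi Si :: "nat \<Rightarrow> behavior set"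
    and M S :: "network_behavior set"
    and W :: "nat \<Rightarrow> nat \<Rightarrow> behavior set"
  assumes "simple_graph {1..N} E"
    and "\<And>i. i \<in> {1..N} \<Longrightarrow> Mi i \<subseteq> behavior_space T (m i) (n i)"
    and "M = (\<Pi>\<^sub>E i\<in>{1..N}. Mi i)"
    and "\<And>i. i \<in> {1..N} \<Longrightarrow> Si i \<subseteq> Mi i"
    and "S \<subseteq> M"
    and "\<And>i j. i \<in> {1..N} \<Longrightarrow> j \<in> neighbors E i \<Longrightarrow> W i j \<subseteq> behavior_space T (m j) (n j)"
    and "\<And>i. i \<in> {1..N} \<Longrightarrow> Si i \<noteq> {}"
  shows "(\<forall>P. coalition_partition {1..N} E P \<longrightarrow>
            contract_composition M P (coalition_contract M E W Si) \<preceq>\<^sub>c (M, S))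
    \<longleftrightarrow>
      (\<forall>i\<in>{1..N}. \<forall>j\<in>neighbors E i. Si j \<subseteq> W i j) \<and>
      (\<Pi>\<^sub>E i\<in>{1..N}. Si i) \<subseteq> S \<and>
      \<not> (\<exists>j1 i1 j2 i2 C D.
            ({j1}, {i1}) \<in> assumption_edges E Mi W (singleton_partition {1..N}) \<and>
            ({j2}, {i2}) \<in> assumption_edges E Mi W (singleton_partition {1..N}) \<and>
            coalition {1..N} E C \<and> coalition {1..N} E D \<and> C \<inter> D = {} \<and>
            {i1, j2} \<subseteq> C \<and> {j1, i2} \<subseteq> D)"
proof -
  let ?V = "{1..N}" and ?A = "assume_set M E W"
  let ?R = "\<lambda>P. \<forall>w\<in>M. (\<forall>C\<in>P. w \<in> ?A C \<longrightarrow> (\<forall>i\<in>C. w i \<in> Si i)) \<longrightarrow> w \<in> S \<and> (\<forall>C\<in>P. w \<in> ?A C)"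
  note nb = neighbors_in_graph[OF assms(1)]
  have edges: "({j}, {i}) \<in> assumption_edges E Mi W (singleton_partition ?V) \<longleftrightarrow>
    j \<in> neighbors E i \<and> \<not> Mi j \<subseteq> W i j" for i j
  proof (cases "i \<in> ?V \<and> j \<in> ?V")
    case True
    then show ?thesis using assumption_edges_singletons[OF assms(1)] by blast
  next
    case False
    then show ?thesis using nb[of j i]
      by (auto simp: assumption_edges_def singleton_partition_def)
  qed
  have sub: "(\<Pi>\<^sub>E i\<in>?V. Si i) \<subseteq> M"
    unfolding assms(3) using assms(4) by (intro PiE_mono)
  \<comment> \<open>Nonempty specifications provide a reference behavior \<open>s\<close>, to be
    altered at one or two agents.\<close>
  obtain s where s: "\<And>i. i \<in> ?V \<Longrightarrow> s i \<in> Si i"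
    using bchoice[of ?V "\<lambda>i x. x \<in> Si i"] assms(7) by blast
  show ?thesis
    unfolding composition_refines_iff edges
  proof (intro iffI conjI)
    assume R: "\<forall>P. coalition_partition ?V E P \<longrightarrow> ?R P"
    \<comment> \<open>For the singleton partition such a \<open>w\<close> meets all guarantees; the
      two conclusions yield (2) and (1).\<close>
    have single: "w \<in> S \<and> (\<forall>i\<in>?V. w \<in> ?A {i})" if w: "w \<in> (\<Pi>\<^sub>E i\<in>?V. Si i)" for w
    proof -
      have "w i \<in> Si i" if "i \<in> ?V" for i using w that by (rule PiE_mem)
      then show ?thesis
        using R[rule_format, OF coalition_partition_singletons, of w] w sub
        by (auto simp: singleton_partition_def)
    qed
    then show "(\<Pi>\<^sub>E i\<in>?V. Si i) \<subseteq> S" by blast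
    show "\<forall>i\<in>?V. \<forall>j\<in>neighbors E i. Si j \<subseteq> W i j"
    proof (intro ballI subsetI)
      fix i j x assume ij: "i \<in> ?V" "j \<in> neighbors E i" and x: "x \<in> Si j"
      have "restrict (s(j := x)) ?V \<in> (\<Pi>\<^sub>E i\<in>?V. Si i)"
        using s x by auto
      from single[OF this] ij nb[OF ij(2)] show "x \<in> W i j"
        by (auto simp: assume_set_iff split: if_splits)
    qed
    show "\<not> (\<exists>j1 i1 j2 i2 C D.
        (j1 \<in> neighbors E i1 \<and> \<not> Mi j1 \<subseteq> W i1 j1) \<and>
        (j2 \<in> neighbors E i2 \<and> \<not> Mi j2 \<subseteq> W i2 j2) \<and>
        coalition ?V E C \<and> coalition ?V E D \<and> C \<inter> D = {} \<and>
        {i1, j2} \<subseteq> C \<and> {j1, i2} \<subseteq> D)"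
    proof (rule notI, elim exE conjE)
      fix j1 i1 j2 i2 C D
      assume *: "j1 \<in> neighbors E i1" "\<not> Mi j1 \<subseteq> W i1 j1" "j2 \<in> neighbors E i2" "\<not> Mi j2 \<subseteq> W i2 j2"
        and CD: "coalition ?V E C" "coalition ?V E D" "C \<inter> D = {}"
          "{i1, j2} \<subseteq> C" "{j1, i2} \<subseteq> D"
      from * obtain x y where 1: "j1 \<in> neighbors E i1" "x \<in> Mi j1" "x \<notin> W i1 j1"
        and 2: "j2 \<in> neighbors E i2" "y \<in> Mi j2" "y \<notin> W i2 j2"
        by blast
      \<comment> \<open>Both altered agents lie in \<open>C\<close> or \<open>D\<close>, so every
        singleton block still meets its specification.\<close>
      define w where "w = restrict (s(j1 := x, j2 := y)) ?V"
      have w: "w \<in> M"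
        unfolding w_def assms(3) using subsetD[OF assms(4) s] 1(2) 2(2) by auto
      have ne: "j1 \<noteq> j2" using CD by auto
      then have wj: "w j1 = x" "w j2 = y"
        using nb[OF 1(1)] nb[OF 2(1)] by (auto simp: w_def)
      \<comment> \<open>\<open>j1\<close> is external to \<open>C\<close> and \<open>j2\<close> to
        \<open>D\<close>, so neither violated assumption is internal to its coalition.\<close>
      have C: "w \<notin> ?A C" and D: "w \<notin> ?A D"
        using 1 2 CD wj by (auto simp: assume_set_iff)
      have "w i \<in> Si i" if "i \<in> ?V" "i \<notin> C" "i \<notin> D" for i
        using that s CD by (auto simp: w_def)
      then have fulfil: "\<forall>X \<in> {C, D} \<union> singleton_partition (?V - C - D). w \<in> ?A X \<longrightarrow> (\<forall>i\<in>X. w i \<in> Si i)"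
        using C D by (auto simp: singleton_partition_def)
      have "?R ({C, D} \<union> singleton_partition (?V - C - D))"
        by (rule R[THEN spec, THEN mp, OF coalition_partition_two[OF CD(1-3)]])
      then have "\<forall>X \<in> {C, D} \<union> singleton_partition (?V - C - D). w \<in> ?A X"
        using w fulfil by blast
      then show False using C by simp
    qed
  next
    assume H: "(\<forall>i\<in>?V. \<forall>j\<in>neighbors E i. Si j \<subseteq> W i j) \<and>
      (\<Pi>\<^sub>E i\<in>?V. Si i) \<subseteq> S \<and>
      \<not> (\<exists>j1 i1 j2 i2 C D.
        (j1 \<in> neighbors E i1 \<and> \<not> Mi j1 \<subseteq> W i1 j1) \<and>
        (j2 \<in> neighbors E i2 \<and> \<not> Mi j2 \<subseteq> W i2 j2) \<and>
        coalition ?V E C \<and> coalition ?V E D \<and> C \<inter> D = {} \<and>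
        {i1, j2} \<subseteq> C \<and> {j1, i2} \<subseteq> D)"
    show "\<forall>P. coalition_partition ?V E P \<longrightarrow> ?R P"
    proof (intro allI impI ballI)
      fix P w
      assume P: "coalition_partition ?V E P" and w: "w \<in> M"
        and fulfil: "\<forall>C\<in>P. w \<in> ?A C \<longrightarrow> (\<forall>i\<in>C. w i \<in> Si i)"
      have Mi: "w i \<in> Mi i" if "i \<in> ?V" for i
        using w that unfolding assms(3) by (rule PiE_mem)
      have A: "w \<in> ?A C" if "C \<in> P" for C
      \<comment> \<open>Since \<open>w j\<close> lies in \<open>Mi j\<close>, a violation
        \<open>w j \<notin> W i j\<close> certifies an edge of the singleton assumption graph, and
        (3) applies.\<close>
      proof (rule all_assumptions_hold[OF assms(1) _ P _ _ w _ that, where Si = Si])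
        fix j1 i1 j2 i2 C D
        assume *: "j1 \<in> neighbors E i1" "w j1 \<notin> W i1 j1" "j2 \<in> neighbors E i2" "w j2 \<notin> W i2 j2"
          "coalition ?V E C" "coalition ?V E D" "C \<inter> D = {}" "i1 \<in> C" "j2 \<in> C" "j1 \<in> D" "i2 \<in> D"
        then have "\<not> Mi j1 \<subseteq> W i1 j1" "\<not> Mi j2 \<subseteq> W i2 j2"
          using Mi nb by blast+
        moreover have "{i1, j2} \<subseteq> C" "{j1, i2} \<subseteq> D" using * by auto
        ultimately show False using H *(1,3,5-7) by metis
      qed (use H fulfil in auto)
      have "\<Union>P = ?V"
        using P by (simp add: coalition_partition_def partition_on_def)
      \<comment> \<open>With no assumption left to excuse a block, every guarantee holds, and (2)
        takes over.\<close>
      then have "w i \<in> Si i" if "i \<in> ?V" for i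
        using that A fulfil by blast
      then have "w \<in> (\<Pi>\<^sub>E i\<in>?V. Si i)"
        using w unfolding assms(3) by (auto simp: PiE_iff)
      then show "w \<in> S \<and> (\<forall>C\<in>P. w \<in> ?A C)"
        using H A by blast
    qed
  qed
qed

end
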